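(* Let $F_4(x)=\dfrac{1}{1-x_1-x_2-x_3-x_4+x_1x_2+x_2x_3+x_3x_4}\in\mathbb{Q}[[x_1,x_2,x_3,x_4]]$ and let $t$ be an indeterminate. Then $$F_4(x)^t=\sum_{h,i,j,k\ge 0}\frac{(t+h+j-1)_j\,(t+h+k-1)_h\,(t+i+k-1)_{i+k}}{h!\,i!\,j!\,k!}\,x_1^hx_2^ix_3^jx_4^k.$$ In particular, $$F_4(x)=\sum_{h,i,j,k\ge 0}\binom{h+j}{j}\binom{h+k}{k}\binom{i+k}{i}x_1^hx_2^ix_3^jx_4^k.$$
   Context: $(y)_r=y(y-1)\cdots(y-r+1)$ denotes the falling factorial, with $(y)_0=1$. For a power series $G=1-u$ with $u$ having zero constant term, $G^{-t}=(1-u)^{-t}$ is defined by $\sum_{m\ge0}\binom{t+m-1}{m}u^m$, so $F_4(x)^t$ is a formal power series in $x_1,\dots,x_4$ whose coefficients are polynomials in $t$. *)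

theory Defs
  imports
    "HOL-Computational_Algebra.Computational_Algebra"
    "HOL-Library.Groups_Big_Fun"
begin

unbundle fps_syntax

text \<open>
  The ring of formal power series in four variables over \<open>'a\<close>, as the iterated ring
  \<open>'a[[x\<^sub>4]][[x\<^sub>3]][[x\<^sub>2]][[x\<^sub>1]]\<close>: the outermost variable is \<open>x\<^sub>1\<close>, so the coefficient of
  \<open>x\<^sub>1\<^sup>h x\<^sub>2\<^sup>i x\<^sub>3\<^sup>j x\<^sub>4\<^sup>k\<close> in \<open>f\<close> is \<open>f $ h $ i $ j $ k\<close>.
\<close>

type_synonym 'a fps4 = "'a fps fps fps fps"

definition X1 :: "'a::comm_ring_1 fps4" where
  "X1 = fps_X"

definition X2 :: "'a::comm_ring_1 fps4" where
  "X2 = fps_const fps_X"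

definition X3 :: "'a::comm_ring_1 fps4" where
  "X3 = fps_const (fps_const fps_X)"

definition X4 :: "'a::comm_ring_1 fps4" where
  "X4 = fps_const (fps_const (fps_const fps_X))"

text \<open>
  \<open>series4 c\<close> is the formal sum of \<open>c h i j k x\<^sub>1\<^sup>h x\<^sub>2\<^sup>i x\<^sub>3\<^sup>j x\<^sub>4\<^sup>k\<close> over all \<open>h, i, j, k \<ge> 0\<close>.
\<close>

definition series4 :: "(nat \<Rightarrow> nat \<Rightarrow> nat \<Rightarrow> nat \<Rightarrow> 'a) \<Rightarrow> 'a fps4" where
  "series4 c = Abs_fps (\<lambda>h. Abs_fps (\<lambda>i. Abs_fps (\<lambda>j. Abs_fps (\<lambda>k. c h i j k))))"

definition falling_fact :: "'a::comm_ring_1 \<Rightarrow> nat \<Rightarrow> 'a" where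
  "falling_fact y r = (\<Prod>i<r. y - of_nat i)"

definition poly_binom :: "rat poly \<Rightarrow> nat \<Rightarrow> rat poly" where
  "poly_binom p m = smult (1 / fact m) (falling_fact p m)"

definition indet :: "rat poly" where
  "indet = [:0, 1:]"

text \<open>
  For \<open>G = 1 - u\<close> with \<open>u\<close> of zero constant term, \<open>neg_pow_indet G\<close> is \<open>G\<^sup>-\<^sup>t\<close>, that is the sum of
  \<open>binomial(t + m - 1, m) u\<^sup>m\<close> over all \<open>m \<ge> 0\<close>, a series with coefficients in \<open>\<rat>[t]\<close>.  The
  sum is taken coefficientwise; each coefficient receives only finitely many nonzero
  contributions (lemma \<open>finite_contributions\<close> below).
\<close>

definition neg_pow_indet :: "rat fps4 \<Rightarrow> rat poly fps4" where
  "neg_pow_indet G = series4 (\<lambda>h i j k.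
     Sum_any (\<lambda>m. smult (((1 - G) ^ m) $ h $ i $ j $ k) (poly_binom (indet + of_nat m - 1) m)))"

definition pow_indet :: "rat fps4 \<Rightarrow> rat poly fps4" where
  "pow_indet F = neg_pow_indet (inverse F)"

definition F4 :: "rat fps4" where
  "F4 = inverse (1 - X1 - X2 - X3 - X4 + X1 * X2 + X2 * X3 + X3 * X4)"

text \<open>
  The library's \<open>inverse\<close> recurses into the constant coefficient; the following facts confirm that
  on series with nonzero constant term it is the multiplicative inverse, so that
  \<open>pow_indet F4\<close> is \<open>G\<^sup>-\<^sup>t\<close> for the denominator \<open>G\<close> of \<open>F4\<close>.
\<close>

lemma inverse_fps4_right:
  fixes f :: "rat fps4"
  assumes "f $ 0 $ 0 $ 0 $ 0 \<noteq> 0"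
  shows "f * inverse f = 1"
proof -
  have 1: "f $ 0 $ 0 $ 0 * inverse (f $ 0 $ 0 $ 0) = 1"
    using assms by (rule inverse_mult_eq_1')
  have 2: "f $ 0 $ 0 * inverse (f $ 0 $ 0) = 1"
    unfolding fps_inverse_def[of "f $ 0 $ 0"] by (rule fps_right_inverse[OF 1])
  have 3: "f $ 0 * inverse (f $ 0) = 1"
    unfolding fps_inverse_def[of "f $ 0"] by (rule fps_right_inverse[OF 2])
  show ?thesis
    unfolding fps_inverse_def[of f] by (rule fps_right_inverse[OF 3])
qed

lemma F4_denominator:
  "F4 * (1 - X1 - X2 - X3 - X4 + X1 * X2 + X2 * X3 + X3 * X4) = 1"
  unfolding F4_def
  by (subst mult.commute, rule inverse_fps4_right) (simp add: X1_def X2_def X3_def X4_def)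

lemma inverse_F4:
  "inverse F4 = 1 - X1 - X2 - X3 - X4 + X1 * X2 + X2 * X3 + X3 * X4" (is "_ = ?G")
proof -
  have "F4 $ 0 $ 0 $ 0 $ 0 \<noteq> 0"
    by (simp add: F4_def X1_def X2_def X3_def X4_def)
  hence "F4 * inverse F4 = 1"
    by (rule inverse_fps4_right)
  hence "inverse F4 = ?G * F4 * inverse F4 \<and> ?G * (F4 * inverse F4) = ?G"
    using F4_denominator by (simp add: mult.commute)
  thus ?thesis
    by (metis mult.assoc)
qed

lemma power_nth_eq_0:
  fixes u :: "rat fps4"
  assumes u: "u $ 0 $ 0 $ 0 $ 0 = 0"
  shows "h + i + j + k < m \<Longrightarrow> (u ^ m) $ h $ i $ j $ k = 0"
proof (induction m arbitrary: h i j k)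
  case (Suc m)
  have "u $ a $ b $ c $ d * (u ^ m) $ (h - a) $ (i - b) $ (j - c) $ (k - d) = 0"
    if "a \<le> h" "b \<le> i" "c \<le> j" "d \<le> k" for a b c d
  proof (cases "a + b + c + d = 0")
    case True
    thus ?thesis using u by simp
  next
    case False
    hence "(h - a) + (i - b) + (j - c) + (k - d) < m"
      using that Suc.prems by linarith
    thus ?thesis using Suc.IH by simp
  qed
  thus ?case
    by (simp only: power_Suc fps_mult_nth fps_sum_nth) (intro sum.neutral ballI, simp)
qed simp

lemma finite_contributions:
  fixes G :: "rat fps4"
  assumes "G $ 0 $ 0 $ 0 $ 0 = 1"
  shows "finite {m. smult (((1 - G) ^ m) $ h $ i $ j $ k) (c m) \<noteq> 0}"
proof (rule finite_subset)
  show "{m. smult (((1 - G) ^ m) $ h $ i $ j $ k) (c m) \<noteq> 0} \<subseteq> {..h + i + j + k}"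
    using power_nth_eq_0[of "1 - G" h i j k] assms by (force simp: not_less)
qed simp

end

theory Submission
  imports Defs
begin

text \<open>
  Write \<open>b y m\<close> for the rising binomial coefficient \<open>y(y+1)\<dots>(y+m-1) / m!\<close>.  The claimed coefficient is
  \<open>b t h * b (t+h) j * b (t+h) k * b (t+k) i\<close>; let \<open>S t\<close> be the series with these coefficients.
  The denominator factors as \<open>G = (1 - x\<^sub>3)(1 - x\<^sub>2 - x\<^sub>4) - x\<^sub>1(1 - x\<^sub>2)\<close>, and multiplying
  \<open>S (t+1)\<close> by the pieces of this expression lowers the argument \<open>t+1\<close> to \<open>t\<close> in one factor
  \<open>b\<close> at a time, by Pascal's rule.  Hence \<open>G * S (t+1) = S t\<close>, and \<open>S n = G\<^sup>-\<^sup>n\<close> for all natural \<open>n\<close>.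
  Both sides of the theorem have coefficients polynomial in \<open>t\<close> that agree at every natural number.
\<close>

section \<open>Rising binomial coefficients and polynomial identities\<close>

definition rising_binom :: "'a::field_char_0 \<Rightarrow> nat \<Rightarrow> 'a" where
  "rising_binom y m = pochhammer y m / fact m"

lemma rising_binom_0 [simp]: "rising_binom y 0 = 1"
  by (simp add: rising_binom_def)

lemma rising_binom_zero_left: "rising_binom 0 m = (if m = 0 then 1 else 0)"
  by (simp add: rising_binom_def pochhammer_0_left)

text \<open>All three terms contain \<open>pochhammer (y + 1) m\<close>; over the denominator
  \<open>fact (Suc m)\<close> the remaining factors are \<open>y + d\<close>, \<open>y\<close> and
  \<open>d\<close>.\<close>

lemma rising_binom_Pascal:
  "rising_binom (y + 1) (Suc m) = rising_binom y (Suc m) + rising_binom (y + 1) m"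
proof -
  define d :: 'a where "d = of_nat (Suc m)"
  have "d \<noteq> 0"
    unfolding d_def by (rule of_nat_neq_0)
  moreover have "pochhammer (y + 1) (Suc m) = pochhammer (y + 1) m * (y + d)"
    by (simp add: pochhammer_Suc d_def add_ac)
  moreover have "pochhammer y (Suc m) = y * pochhammer (y + 1) m"
    by (simp add: pochhammer_rec)
  moreover have "fact (Suc m) = d * fact m"
    by (simp add: d_def)
  ultimately show ?thesis
    by (simp add: rising_binom_def field_simps)
qed

lemma rising_binom_of_nat: "rising_binom (1 + of_nat n) m = of_nat ((n + m) choose m)"
proof -
  have "(fact n :: 'a) * pochhammer (1 + of_nat n) m = fact (n + m)"
    using pochhammer_product'[of "1 :: 'a" n m] by (simp add: pochhammer_fact)
  thus ?thesis
    by (simp add: rising_binom_def binomial_fact field_simps)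
qed

text \<open>Descending from \<open>y + of_nat m - 1\<close>, the \<open>m\<close> factors end
  exactly at \<open>y\<close>: the rising product read backwards.\<close>

lemma falling_fact_eq_pochhammer:
  "falling_fact (y + of_nat m - 1) m = pochhammer y m"
proof -
  have "falling_fact (y + of_nat m - 1) m = (\<Prod>i<m. y + of_nat (m - Suc i))"
    unfolding falling_fact_def by (intro prod.cong) (auto simp: of_nat_diff)
  also have "\<dots> = (\<Prod>i<m. y + of_nat i)"
    by (rule prod.nat_diff_reindex)
  finally show ?thesis
    by (simp add: pochhammer_prod atLeast0LessThan)
qed

lemma poly_pochhammer: "poly (pochhammer p m) x = pochhammer (poly p x) m"
  by (simp add: pochhammer_prod poly_prod)

text \<open>A nonzero difference has finitely many roots, but in characteristic zero the natural
  numbers supply infinitely many.\<close>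

lemma poly_eqI_of_nat:
  fixes p q :: "'a::{idom, ring_char_0} poly"
  assumes "\<And>n. poly p (of_nat n) = poly q (of_nat n)"
  shows "p = q"
proof (rule ccontr)
  assume "p \<noteq> q"
  hence "finite {x. poly (p - q) x = 0}"
    by (intro poly_roots_finite) simp
  moreover have "range of_nat \<subseteq> {x. poly (p - q) x = 0}"
    using assms by auto
  ultimately have "finite (range (of_nat :: nat \<Rightarrow> 'a))"
    by (rule rev_finite_subset)
  thus False
    using finite_imageD[OF _ inj_of_nat] infinite_UNIV_nat by blast
qed

section \<open>Coefficients of series in four variables\<close>

lemma series4_nth [simp]: "series4 c $ h $ i $ j $ k = c h i j k"
  by (simp add: series4_def)

lemma fps4_eqI:
  fixes f g :: "'a::comm_ring_1 fps4"
  assumes "\<And>h i j k. f $ h $ i $ j $ k = g $ h $ i $ j $ k"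
  shows "f = g"
  using assms by (simp add: fps_eq_iff)

lemma one_fps4_nth:
  "(1 :: 'a::comm_ring_1 fps4) $ h $ i $ j $ k = (if h = 0 \<and> i = 0 \<and> j = 0 \<and> k = 0 then 1 else 0)"
  by simp

lemma X_mult_nth:
  fixes f :: "'a::comm_ring_1 fps4"
  shows "(X1 * f) $ h $ i $ j $ k = (case h of 0 \<Rightarrow> 0 | Suc h' \<Rightarrow> f $ h' $ i $ j $ k)"
    and "(X2 * f) $ h $ i $ j $ k = (case i of 0 \<Rightarrow> 0 | Suc i' \<Rightarrow> f $ h $ i' $ j $ k)"
    and "(X3 * f) $ h $ i $ j $ k = (case j of 0 \<Rightarrow> 0 | Suc j' \<Rightarrow> f $ h $ i $ j' $ k)"
    and "(X4 * f) $ h $ i $ j $ k = (case k of 0 \<Rightarrow> 0 | Suc k' \<Rightarrow> f $ h $ i $ j $ k')"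
  by (simp_all add: X1_def X2_def X3_def X4_def fps_mult_left_const_nth split: nat.split)

section \<open>The recurrence and the natural powers of \<open>F4\<close>\<close>

definition F4_pow :: "rat \<Rightarrow> rat fps4" where
  "F4_pow t = series4 (\<lambda>h i j k. rising_binom t h * rising_binom (t + of_nat h) j
     * rising_binom (t + of_nat h) k * rising_binom (t + of_nat k) i)"

lemma F4_pow_0: "F4_pow 0 = 1"
  by (rule fps4_eqI) (auto simp: F4_pow_def one_fps4_nth rising_binom_zero_left)

lemma denominator_mult_F4_pow:
  "(1 - X1 - X2 - X3 - X4 + X1 * X2 + X2 * X3 + X3 * X4) * F4_pow (t + 1) = F4_pow t"
proof -
  define b :: "rat \<Rightarrow> nat \<Rightarrow> rat" where "b = rising_binom"
  have Pascal: "b (1 + y) (Suc m) = b y (Suc m) + b (1 + y) m" for y m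
    using rising_binom_Pascal[of y m] by (simp add: b_def add.commute)
  have b0 [simp]: "b y 0 = 1" for y
    by (simp add: b_def)
  let ?S = "F4_pow (t + 1)"
  have S: "?S = series4 (\<lambda>h i j k. b (t + 1) h * b (t + of_nat h + 1) j
             * b (t + of_nat h + 1) k * b (t + of_nat k + 1) i)"
    by (simp add: F4_pow_def b_def algebra_simps)
  \<comment> \<open>\<open>Q\<close>, \<open>R\<close> and \<open>T\<close> lower the upper argument
    of one factor at a time: first the factor in \<open>i\<close>, then \<open>k\<close>, then
    \<open>j\<close>. The factor in \<open>h\<close> comes last and gives
    \<open>F4_pow t\<close>.\<close>
  define Q where "Q = series4 (\<lambda>h i j k. b (t + 1) h * b (t + of_nat h + 1) j
             * b (t + of_nat h + 1) k * b (t + of_nat k) i)"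
  define R where "R = series4 (\<lambda>h i j k. b (t + 1) h * b (t + of_nat h + 1) j
             * b (t + of_nat h) k * b (t + of_nat k) i)"
  define T where "T = series4 (\<lambda>h i j k. b (t + 1) h * b (t + of_nat h) j
             * b (t + of_nat h) k * b (t + of_nat k) i)"
  have Q: "?S - X2 * ?S = Q"
    unfolding S by (rule fps4_eqI)
      (simp add: Q_def X_mult_nth Pascal algebra_simps split: nat.split)
  \<comment> \<open>The product is \<open>X4 * ?S\<close>, not \<open>X4 * Q\<close>: shifting
    \<open>k\<close> already turns \<open>t + of_nat k + 1\<close> into \<open>t + of_nat k\<close>
    in the last factor, so only Pascal's rule in \<open>k\<close> remains.\<close>
  have R: "Q - X4 * ?S = R"
    unfolding S by (rule fps4_eqI)
      (simp add: Q_def R_def X_mult_nth Pascal algebra_simps split: nat.split)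
  have T: "R - X3 * R = T"
    by (rule fps4_eqI)
      (simp add: R_def T_def X_mult_nth Pascal algebra_simps split: nat.split)
  \<comment> \<open>Shifting \<open>h\<close> in \<open>Q\<close> lowers the arguments of the
    factors in \<open>j\<close> and \<open>k\<close> to those of \<open>T\<close>, leaving Pascal's
    rule in \<open>h\<close>.\<close>
  have U: "T - X1 * Q = F4_pow t"
    by (rule fps4_eqI)
      (simp add: Q_def T_def F4_pow_def b_def[symmetric] X_mult_nth Pascal algebra_simps
        split: nat.split)
  have "(1 - X1 - X2 - X3 - X4 + X1 * X2 + X2 * X3 + X3 * X4) * ?S
      = ((?S - X2 * ?S) - X4 * ?S) - X3 * ((?S - X2 * ?S) - X4 * ?S) - X1 * (?S - X2 * ?S)"
    by (simp add: algebra_simps)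
  thus ?thesis
    by (simp only: Q R T U)
qed

lemma F4_power: "F4 ^ n = F4_pow (of_nat n)"
proof (induction n)
  case 0
  show ?case by (simp add: F4_pow_0)
next
  case (Suc n)
  let ?G = "1 - X1 - X2 - X3 - X4 + X1 * X2 + X2 * X3 + X3 * X4 :: rat fps4"
  \<comment> \<open>The recurrence, read backwards, inserts the denominator into the induction
    hypothesis, so that the new factor \<open>F4\<close> cancels it.\<close>
  have "F4 ^ Suc n = F4 * (?G * F4_pow (of_nat n + 1))"
    by (simp only: power_Suc Suc.IH denominator_mult_F4_pow)
  also have "\<dots> = F4_pow (of_nat n + 1)"
    by (simp only: mult.assoc[symmetric] F4_denominator mult_1_left)
  finally show ?case
    by (simp add: add.commute)
qed

section \<open>The binomial series at natural exponents\<close>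

lemma power_mult_nth_eq_0:
  fixes u r :: "rat fps4"
  assumes "u $ 0 $ 0 $ 0 $ 0 = 0" and "h + i + j + k < m"
  shows "(u ^ m * r) $ h $ i $ j $ k = 0"
proof -
  have "(u ^ m) $ a $ b $ c $ d = 0" if "a \<le> h" "b \<le> i" "c \<le> j" "d \<le> k" for a b c d
    using that assms by (intro power_nth_eq_0) auto
  thus ?thesis
    by (simp only: fps_mult_nth fps_sum_nth) (intro sum.neutral ballI, simp)
qed

text \<open>The binomial series for \<open>(1 - u)\<^sup>-\<^sup>n\<close>, truncated so that no convergence is involved.\<close>

lemma power_dvd_binomial_series_remainder:
  fixes u F :: "rat fps4"
  assumes F: "F * (1 - u) = 1"
  defines "c \<equiv> \<lambda>x. fps_const (fps_const (fps_const (fps_const x)))"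
  shows "u ^ Suc M dvd F ^ n - (\<Sum>m\<le>M. c (rising_binom (of_nat n) m) * u ^ m)"
proof (induction n)
  case 0
  have "(\<Sum>m\<le>M. c (rising_binom 0 m) * u ^ m) = (\<Sum>m\<le>M. if m = 0 then 1 else 0)"
    by (intro sum.cong) (auto simp: rising_binom_zero_left c_def)
  thus ?case by simp
next
  case (Suc n)
  let ?T = "\<lambda>n M. \<Sum>m\<le>M. c (rising_binom (of_nat n) m) * u ^ m"
  let ?r = "\<lambda>M. c (rising_binom (of_nat (Suc n)) M)"
  \<comment> \<open>By Pascal's rule, multiplying by \<open>1 - u\<close> lowers the exponent from
    \<open>Suc n\<close> to \<open>n\<close>; the truncation leaves one boundary term, a multiple of
    \<open>u ^ Suc M\<close>.\<close>
  have step: "(1 - u) * ?T (Suc n) M = ?T n M - ?r M * u ^ Suc M" for M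
  proof (induction M)
    case 0
    show ?case by (simp add: c_def)
  next
    case (Suc M)
    have Pascal: "?r (Suc M)
        = c (rising_binom (of_nat n) (Suc M)) + ?r M"
      using rising_binom_Pascal[of "of_nat n" M] by (simp add: c_def add.commute)
    have "(1 - u) * ?T (Suc n) (Suc M)
        = (1 - u) * ?T (Suc n) M + (1 - u) * (?r (Suc M) * u ^ Suc M)"
      by (simp only: sum.atMost_Suc distrib_left)
    also have "\<dots> = ?T n M + c (rising_binom (of_nat n) (Suc M)) * u ^ Suc M
        - ?r (Suc M) * u ^ Suc (Suc M)"
      unfolding Suc.IH using Pascal by (simp add: algebra_simps)
    finally show ?case
      by (simp only: sum.atMost_Suc)
  qed
  have "F * ((1 - u) * ?T (Suc n) M) = ?T (Suc n) M"
    by (simp only: mult.assoc[symmetric] F mult_1_left)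
  hence "F ^ Suc n - ?T (Suc n) M = F * (F ^ n - (1 - u) * ?T (Suc n) M)"
    by (simp only: right_diff_distrib power_Suc)
  also have "\<dots> = F * ((F ^ n - ?T n M) + ?r M * u ^ Suc M)"
    unfolding step by (simp only: diff_diff_eq2 diff_add_eq)
  finally show ?case
    using Suc.IH by (simp only:) (intro dvd_mult dvd_add dvd_triv_right)
qed

text \<open>With \<open>u = 1 - G\<close>, the power \<open>u ^ m\<close> starts in total degree
  \<open>m\<close>. In degree \<open>M\<close> the defining sum therefore stops at
  \<open>m = M\<close>, and the remainder, divisible by \<open>u ^ Suc M\<close>, is
  invisible.\<close>

lemma poly_neg_pow_indet_nth:
  fixes G F :: "rat fps4"
  assumes G: "G $ 0 $ 0 $ 0 $ 0 = 1" and FG: "F * G = 1"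
  shows "poly (neg_pow_indet G $ h $ i $ j $ k) (of_nat n) = (F ^ n) $ h $ i $ j $ k"
proof -
  define u where "u = 1 - G"
  define M where "M = h + i + j + k"
  define c :: "rat \<Rightarrow> rat fps4" where "c = (\<lambda>x. fps_const (fps_const (fps_const (fps_const x))))"
  let ?T = "\<Sum>m\<le>M. c (rising_binom (of_nat n) m) * u ^ m"
  have u0: "u $ 0 $ 0 $ 0 $ 0 = 0"
    using G by (simp add: u_def)
  have binom: "poly (poly_binom (indet + of_nat m - 1) m) (of_nat n) = rising_binom (of_nat n) m" for m
    by (simp add: poly_binom_def falling_fact_eq_pochhammer poly_pochhammer rising_binom_def indet_def)
  have "neg_pow_indet G $ h $ i $ j $ k
      = (\<Sum>m\<le>M. smult ((u ^ m) $ h $ i $ j $ k) (poly_binom (indet + of_nat m - 1) m))"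
    unfolding neg_pow_indet_def series4_nth u_def[symmetric]
  proof (rule Sum_any.expand_superset)
    show "{m. smult ((u ^ m) $ h $ i $ j $ k) (poly_binom (indet + of_nat m - 1) m) \<noteq> 0} \<subseteq> {..M}"
      using power_nth_eq_0[OF u0, of h i j k] by (force simp: M_def not_less)
  qed simp
  hence "poly (neg_pow_indet G $ h $ i $ j $ k) (of_nat n) = ?T $ h $ i $ j $ k"
    by (simp add: poly_sum binom c_def fps_sum_nth fps_mult_left_const_nth mult.commute)
  also have "\<dots> = (F ^ n) $ h $ i $ j $ k"
  proof -
    have "u ^ Suc M dvd F ^ n - ?T"
      unfolding c_def by (rule power_dvd_binomial_series_remainder) (simp add: u_def FG)
    then obtain r where "F ^ n - ?T = u ^ Suc M * r" ..
    hence "(F ^ n - ?T) $ h $ i $ j $ k = 0"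
      using power_mult_nth_eq_0[OF u0, of h i j k "Suc M" r] by (simp add: M_def)
    thus ?thesis by simp
  qed
  finally show ?thesis .
qed

section \<open>The closed form of the coefficients\<close>

lemma pochhammer_product_eq_rising_binom:
  fixes t :: "'a::field_char_0"
  shows "1 / (fact h * fact i * fact j * fact k)
      * (pochhammer (t + of_nat h) j * pochhammer (t + of_nat k) h * pochhammer t (i + k))
    = rising_binom t h * rising_binom (t + of_nat h) j
      * rising_binom (t + of_nat h) k * rising_binom (t + of_nat k) i"
proof -
  have "pochhammer t (i + k) = pochhammer t k * pochhammer (t + of_nat k) i"
    by (metis pochhammer_product' add.commute)
  \<comment> \<open>Both sides equal \<open>pochhammer t (h + k)\<close>, split after
    \<open>k\<close> or after \<open>h\<close> factors; this exchange makes the product fit the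
    recurrence.\<close>
  moreover have "pochhammer t k * pochhammer (t + of_nat k) h
      = pochhammer t h * pochhammer (t + of_nat h) k"
    by (metis pochhammer_product' add.commute)
  ultimately have "pochhammer (t + of_nat h) j * pochhammer (t + of_nat k) h * pochhammer t (i + k)
      = pochhammer t h * pochhammer (t + of_nat h) j * pochhammer (t + of_nat h) k
        * pochhammer (t + of_nat k) i"
    by (simp add: mult_ac)
  thus ?thesis
    by (simp add: rising_binom_def mult_ac)
qed

theorem theorem2p3:
  shows "pow_indet F4 = series4 (\<lambda>h i j k.
           smult (1 / (fact h * fact i * fact j * fact k))
             (falling_fact (indet + of_nat h + of_nat j - 1) j
              * falling_fact (indet + of_nat h + of_nat k - 1) h
              * falling_fact (indet + of_nat i + of_nat k - 1) (i + k)))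
       \<and> F4 = series4 (\<lambda>h i j k.
           of_nat ((h + j) choose j) * of_nat ((h + k) choose k) * of_nat ((i + k) choose i))"
proof (intro conjI fps4_eqI poly_eqI_of_nat)
  fix h i j k n :: nat
  have G0: "inverse F4 $ 0 $ 0 $ 0 $ 0 = 1"
    by (simp add: inverse_F4 X1_def X2_def X3_def X4_def)
  have FG: "F4 * inverse F4 = 1"
    unfolding inverse_F4 by (rule F4_denominator)
  have ff: "falling_fact (indet + of_nat h + of_nat j - 1) j = pochhammer (indet + of_nat h) j"
    "falling_fact (indet + of_nat h + of_nat k - 1) h = pochhammer (indet + of_nat k) h"
    "falling_fact (indet + of_nat i + of_nat k - 1) (i + k) = pochhammer indet (i + k)"
    using falling_fact_eq_pochhammer[of "indet + of_nat h" j]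
      falling_fact_eq_pochhammer[of "indet + of_nat k" h]
      falling_fact_eq_pochhammer[of indet "i + k"]
    by (simp_all add: add_ac)
  have "poly (pow_indet F4 $ h $ i $ j $ k) (of_nat n) = F4_pow (of_nat n) $ h $ i $ j $ k"
    unfolding pow_indet_def by (simp only: poly_neg_pow_indet_nth[OF G0 FG] F4_power)
  also have "\<dots> = poly (smult (1 / (fact h * fact i * fact j * fact k))
             (falling_fact (indet + of_nat h + of_nat j - 1) j
              * falling_fact (indet + of_nat h + of_nat k - 1) h
              * falling_fact (indet + of_nat i + of_nat k - 1) (i + k))) (of_nat n)"
    unfolding ff F4_pow_def series4_nth pochhammer_product_eq_rising_binom[symmetric]
    by (simp add: poly_pochhammer indet_def)
  finally show "poly (pow_indet F4 $ h $ i $ j $ k) (of_nat n) = poly (series4 (\<lambda>h i j k.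
           smult (1 / (fact h * fact i * fact j * fact k))
             (falling_fact (indet + of_nat h + of_nat j - 1) j
              * falling_fact (indet + of_nat h + of_nat k - 1) h
              * falling_fact (indet + of_nat i + of_nat k - 1) (i + k))) $ h $ i $ j $ k) (of_nat n)"
    by (simp only: series4_nth)
next
  fix h i j k :: nat
  \<comment> \<open>The second formula is the case of exponent 1, where the factor in
    \<open>h\<close> becomes 1 and the other three become ordinary binomial coefficients.\<close>
  have "rising_binom 1 h = (1 :: rat)"
    using rising_binom_of_nat[of 0 h, where 'a = rat] by simp
  moreover have "(k + i) choose i = (i + k) choose i"
    by (simp add: add.commute)
  moreover have "F4 $ h $ i $ j $ k = F4_pow 1 $ h $ i $ j $ k"
    using F4_power[of 1] by simp
  ultimately show "F4 $ h $ i $ j $ k = series4 (\<lambda>h i j k.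
      of_nat ((h + j) choose j) * of_nat ((h + k) choose k) * of_nat ((i + k) choose i)) $ h $ i $ j $ k"
    by (simp add: F4_pow_def rising_binom_of_nat)
qed

end
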